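(* Let $s_1,\dots,s_n\in\mathbb{R}^2$ ($n\ge 2$) be stations with powers $\psi_1,\dots,\psi_n>0$, path-loss exponent $\alpha=2$, and let $I(p)=\sum_{i=2}^{n}\psi_i\,\|s_i-p\|^{-2}$ be the interference at $p$ caused by $s_2,\dots,s_n$. Then $I$ satisfies the maximum principle: for every nonempty closed connected set $D\subseteq\mathbb{R}^2$ with $D\cap\{s_2,\dots,s_n\}=\emptyset$ and every $p\in D$, one has $I(p)\le\sup_{q\in\partial D}I(q)$, where $\partial D$ is the boundary of $D$. *)

theory Defs
  imports "HOL-Analysis.Analysis"
begin

text \<open>
  Interference at \<open>p\<close> caused by the stations \<open>s 2, \<dots>, s n\<close> (every station but the
  first one) with powers \<open>\<psi> i\<close> and path-loss exponent \<open>\<alpha>\<close>.  Stations are indexed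
  from 1.  At the interfering stations themselves, where the interference is infinite,
  the corresponding summand is 0 by \<open>0 powr a = 0\<close>; these points carry no meaning.
\<close>

definition interference ::
  "real \<Rightarrow> nat \<Rightarrow> (nat \<Rightarrow> real ^ 2) \<Rightarrow> (nat \<Rightarrow> real) \<Rightarrow> real ^ 2 \<Rightarrow> real" where
  "interference \<alpha> n s \<psi> p = (\<Sum>i=2..n. \<psi> i * norm (s i - p) powr (- \<alpha>))"

end

theory Submission
  imports Defs
begin

text \<open>
  The function \<open>1 / norm x ^ 2\<close> on the punctured plane is strictly subharmonic. This is used in a
  discrete form: for \<open>0 < h < norm x\<close> its value at \<open>x\<close> is smaller than the average of its
  values at the four points at distance \<open>h\<close> from \<open>x\<close> in the coordinate directions. Hence the
  interference has no local maximum away from the stations. As it is positive and vanishes at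
  infinity, it attains its maximum over \<open>D\<close>, even if \<open>D\<close> is unbounded, and a maximum point has to
  lie on the frontier.
\<close>

text \<open>The fractions are paired by opposite points. In both pairs the denominators have the
  same sum, so each pair reduces to one fraction, and the inequality of arithmetic and harmonic
  means bounds the two from below.\<close>

lemma inverse_square_less_four_point_sum:
  fixes u v h :: real
  assumes "0 < h" and "h\<^sup>2 < u\<^sup>2 + v\<^sup>2"
  shows "4 / (u\<^sup>2 + v\<^sup>2) < 1 / ((u - h)\<^sup>2 + v\<^sup>2) + 1 / ((u + h)\<^sup>2 + v\<^sup>2)
           + 1 / (u\<^sup>2 + (v - h)\<^sup>2) + 1 / (u\<^sup>2 + (v + h)\<^sup>2)"
proof -
  define a where "a = u\<^sup>2 + v\<^sup>2"
  \<comment> \<open>In each opposite pair the squared norms add up to \<open>2 * A\<close>; their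
    products are \<open>X\<close> and \<open>Y\<close>.\<close>
  define A where "A = a + h\<^sup>2"
  define X where "X = A\<^sup>2 - 4 * h\<^sup>2 * u\<^sup>2"
  define Y where "Y = A\<^sup>2 - 4 * h\<^sup>2 * v\<^sup>2"
  have a: "h\<^sup>2 < a" "0 < h\<^sup>2"
    using assms by (auto simp: a_def)
  then have "0 < a"
    by linarith
  with a have A: "0 < A"
    unfolding A_def by linarith
  \<comment> \<open>Since \<open>h\<^sup>2 < a\<close>, none of the four points is the origin, so
    both products are positive.\<close>
  have "0 < (a - h\<^sup>2)\<^sup>2"
    using a by simp
  moreover have "X = (a - h\<^sup>2)\<^sup>2 + 4 * h\<^sup>2 * v\<^sup>2" "Y = (a - h\<^sup>2)\<^sup>2 + 4 * h\<^sup>2 * u\<^sup>2"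
    unfolding X_def Y_def A_def a_def by algebra+
  ultimately have XY: "0 < X" "0 < Y"
    by (simp_all add: add_pos_nonneg)
  have pair: "1 / P + 1 / Q = 2 * A / (P * Q)" if "P + Q = 2 * A" "P * Q > 0" for P Q :: real
    using that by (auto simp: divide_simps)
  have X: "((u - h)\<^sup>2 + v\<^sup>2) * ((u + h)\<^sup>2 + v\<^sup>2) = X"
    unfolding X_def A_def a_def by algebra
  have Y: "(u\<^sup>2 + (v - h)\<^sup>2) * (u\<^sup>2 + (v + h)\<^sup>2) = Y"
    unfolding Y_def A_def a_def by algebra
  have "1 / ((u - h)\<^sup>2 + v\<^sup>2) + 1 / ((u + h)\<^sup>2 + v\<^sup>2) = 2 * A / X"
    unfolding X[symmetric] using X XY
    by (intro pair) (auto simp: A_def a_def power2_eq_square algebra_simps)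
  moreover have "1 / (u\<^sup>2 + (v - h)\<^sup>2) + 1 / (u\<^sup>2 + (v + h)\<^sup>2) = 2 * A / Y"
    unfolding Y[symmetric] using Y XY
    by (intro pair) (auto simp: A_def a_def power2_eq_square algebra_simps)
  moreover have "4 / a < 2 * A / X + 2 * A / Y"
  proof -
    have sum: "X + Y = 2 * (a\<^sup>2 + h ^ 4)"
      unfolding X_def Y_def A_def a_def by algebra
    \<comment> \<open>This is \<open>h\<^sup>2 < a\<close> multiplied by \<open>h\<^sup>2\<close>,
      and the only source of strictness.\<close>
    have "a\<^sup>2 + h ^ 4 < a * A"
      using mult_strict_right_mono[OF a]
      by (simp add: A_def power2_eq_square power4_eq_xxxx algebra_simps)
    then have "4 * (X + Y) < 8 * (a * A)"
      using sum by simp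
    then have "4 / a < 8 * A / (X + Y)"
      using \<open>0 < a\<close> XY by (simp add: field_simps)
    also have "4 * (X * Y) \<le> (X + Y)\<^sup>2"
      using zero_le_power2[of "X - Y"] by (simp add: power2_eq_square algebra_simps)
    then have "4 / (X + Y) \<le> 1 / X + 1 / Y"
      using XY by (simp add: divide_simps power2_eq_square algebra_simps)
    then have "2 * A * (4 / (X + Y)) \<le> 2 * A * (1 / X + 1 / Y)"
      using A by (intro mult_left_mono) auto
    then have "8 * A / (X + Y) \<le> 2 * A / X + 2 * A / Y"
      by (simp add: algebra_simps)
    finally show ?thesis .
  qed
  ultimately show ?thesis
    unfolding a_def by linarith
qed

lemma norm_inverse_square_less_four_point_sum:
  fixes y :: "real ^ 2"
  assumes "0 < h" and "h < norm y"
  shows "4 / (norm y)\<^sup>2 <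
    1 / (norm (y - axis 1 h))\<^sup>2 + 1 / (norm (y + axis 1 h))\<^sup>2
      + 1 / (norm (y - axis 2 h))\<^sup>2 + 1 / (norm (y + axis 2 h))\<^sup>2"
proof -
  have norm2: "(norm z)\<^sup>2 = (z $ 1)\<^sup>2 + (z $ 2)\<^sup>2" for z :: "real ^ 2"
    unfolding power2_norm_eq_inner by (simp add: inner_vec_def sum_2 power2_eq_square)
  have "h\<^sup>2 < (norm y)\<^sup>2"
    using assms by (intro power_strict_mono) auto
  then show ?thesis
    using inverse_square_less_four_point_sum[of h "y $ 1" "y $ 2"] assms
    by (simp add: norm2 axis_def)
qed

text \<open>At a station both sides are 0, as \<open>0 powr a = 0\<close> and \<open>x / 0 = 0\<close>.\<close>

lemma interference_2_eq: "interference 2 n s \<psi> p = (\<Sum>i=2..n. \<psi> i * (1 / (norm (s i - p))\<^sup>2))"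
  unfolding interference_def by (intro sum.cong) (auto simp: powr_minus_divide)

text \<open>The pointwise inequality at \<open>y = s i - x\<close> is weighted by
  \<open>\<psi> i\<close> and summed; \<open>n \<ge> 2\<close> makes the sum nonempty and thus keeps
  it strict.\<close>

lemma interference_less_four_point_sum:
  assumes "n \<ge> 2" and "\<And>i. i \<in> {2..n} \<Longrightarrow> \<psi> i > 0"
    and "0 < h" and "\<And>i. i \<in> {2..n} \<Longrightarrow> h < norm (s i - x)"
  shows "4 * interference 2 n s \<psi> x <
    interference 2 n s \<psi> (x + axis 1 h) + interference 2 n s \<psi> (x - axis 1 h)
      + interference 2 n s \<psi> (x + axis 2 h) + interference 2 n s \<psi> (x - axis 2 h)"
proof -
  have "(\<Sum>i=2..n. \<psi> i * (4 / (norm (s i - x))\<^sup>2)) <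
    (\<Sum>i=2..n. \<psi> i * (1 / (norm (s i - x - axis 1 h))\<^sup>2 + 1 / (norm (s i - x + axis 1 h))\<^sup>2
      + 1 / (norm (s i - x - axis 2 h))\<^sup>2 + 1 / (norm (s i - x + axis 2 h))\<^sup>2))"
    using assms
    by (intro sum_strict_mono mult_strict_left_mono norm_inverse_square_less_four_point_sum) auto
  \<comment> \<open>This rewrites the left side of the strict inequality.\<close>
  also have "(\<Sum>i=2..n. \<psi> i * (4 / (norm (s i - x))\<^sup>2)) = 4 * interference 2 n s \<psi> x"
    by (simp add: interference_2_eq sum_distrib_left mult.commute)
  finally show ?thesis
    unfolding interference_2_eq sum.distrib[symmetric] distrib_left[symmetric]
    by (simp add: algebra_simps)
qed

lemma continuous_on_interference:
  assumes "D \<inter> s ` {2..n} = {}"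
  shows "continuous_on D (interference \<alpha> n s \<psi>)"
proof -
  have "s i - x \<noteq> 0" if "x \<in> D" "i \<in> {2..n}" for x i
    using assms that by auto
  then show ?thesis
    unfolding interference_def[abs_def] by (intro continuous_intros) auto
qed

text \<open>Each distance \<open>norm (s i - p)\<close> is at least
  \<open>norm p - norm (s i)\<close>, so every summand decays.\<close>

lemma tendsto_interference_at_infinity:
  assumes "\<alpha> > 0"
  shows "(interference \<alpha> n s \<psi> \<longlongrightarrow> 0) at_infinity"
proof -
  have "((\<lambda>p. \<psi> i * norm (s i - p) powr (- \<alpha>)) \<longlongrightarrow> 0) at_infinity" for i
  proof -
    have "filterlim (\<lambda>p. - norm (s i) + norm p) at_top at_infinity"
      by (intro filterlim_tendsto_add_at_top[OF tendsto_const] filterlim_norm_at_top)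
    then have "filterlim (\<lambda>p. norm (s i - p)) at_top at_infinity"
      by (rule filterlim_at_top_mono)
        (auto intro!: always_eventually norm_triangle_ineq2 simp: norm_minus_commute[of "s i"])
    then have "((\<lambda>p. norm (s i - p) powr (- \<alpha>)) \<longlongrightarrow> 0) at_infinity"
      using assms by (intro tendsto_neg_powr) auto
    then show ?thesis
      by (rule tendsto_mult_right_zero)
  qed
  then show ?thesis
    unfolding interference_def[abs_def] by (intro tendsto_null_sum) auto
qed

theorem theorem7p3:
  fixes n :: nat and s :: "nat \<Rightarrow> real ^ 2" and \<psi> :: "nat \<Rightarrow> real"
    and D :: "(real ^ 2) set" and p :: "real ^ 2"
  assumes "n \<ge> 2"
    and "\<And>i. i \<in> {1..n} \<Longrightarrow> \<psi> i > 0"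
    and "D \<noteq> {}" and "closed D" and "connected D"
    and "D \<inter> s ` {2..n} = {}"
    and "p \<in> D"
  shows "ereal (interference 2 n s \<psi> p) \<le> (SUP q\<in>frontier D. ereal (interference 2 n s \<psi> q))"
proof -
  let ?I = "interference 2 n s \<psi>"
  have pos: "\<psi> i > 0" if "i \<in> {2..n}" for i
    using assms(2) that by auto
  have "0 < ?I p"
    unfolding interference_2_eq using assms(1,6,7) pos
    by (intro sum_pos mult_pos_pos) auto
  then have "\<forall>\<^sub>F q in at_infinity. ?I q < ?I p"
    using tendsto_interference_at_infinity[of 2] by (intro order_tendstoD) auto
  then obtain R where R: "\<And>q. R \<le> norm q \<Longrightarrow> ?I q < ?I p"
    unfolding eventually_at_infinity by blast
  \<comment> \<open>Outside the ball \<open>R\<close> would give \<open>?I p < ?I p\<close>.\<close>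
  have p: "p \<in> D \<inter> cball 0 R"
    using R[of p] assms(7) by force
  have "compact (D \<inter> cball 0 R)"
    using assms(4) by (intro closed_Int_compact) auto
  moreover have "continuous_on (D \<inter> cball 0 R) ?I"
    using assms(6) by (intro continuous_on_interference) auto
  ultimately obtain x where x: "x \<in> D \<inter> cball 0 R" "\<And>q. q \<in> D \<inter> cball 0 R \<Longrightarrow> ?I q \<le> ?I x"
    using continuous_attains_sup[of "D \<inter> cball 0 R" ?I] p by blast
  \<comment> \<open>Beyond the ball the values stay below \<open>?I p\<close>, hence below
    \<open>?I x\<close>.\<close>
  have max: "?I q \<le> ?I x" if "q \<in> D" for q
  proof (cases "norm q \<le> R")
    case True
    then show ?thesis
      using x(2)[of q] that by simp
  next
    case False
    then show ?thesis
      using R[of q] x(2)[OF p] by simp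
  qed
  have "x \<notin> interior D"
  proof
    assume "x \<in> interior D"
    then obtain h where h: "0 < h" "cball x h \<subseteq> D"
      unfolding mem_interior_cball by blast
    \<comment> \<open>The ball lies in \<open>D\<close>, which contains no interfering
      station.\<close>
    have "h < norm (s i - x)" if "i \<in> {2..n}" for i
    proof -
      have "s i \<notin> cball x h"
        using h(2) assms(6) that by blast
      then show ?thesis
        by (simp add: dist_norm norm_minus_commute)
    qed
    then have less: "4 * ?I x < ?I (x + axis 1 h) + ?I (x - axis 1 h)
        + ?I (x + axis 2 h) + ?I (x - axis 2 h)"
      using assms(1) pos h(1) by (intro interference_less_four_point_sum) auto
    \<comment> \<open>These points are at distance exactly \<open>h\<close>, so a closed ball is
      used. By maximality their four values sum to at most \<open>4 * ?I x\<close>.\<close>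
    have "x + axis j h \<in> D" "x - axis j h \<in> D" for j
      using h by (auto intro!: subsetD[OF h(2)] simp: dist_norm norm_eq_sqrt_inner inner_axis_axis)
    then show False
      using less max[of "x + axis 1 h"] max[of "x - axis 1 h"]
        max[of "x + axis 2 h"] max[of "x - axis 2 h"] by force
  qed
  then have "x \<in> frontier D"
    using x(1) closure_subset by (auto simp: frontier_def)
  moreover have "?I p \<le> ?I x"
    using max assms(7) by blast
  ultimately show ?thesis
    by (intro SUP_upper2[of x]) auto
qed

end
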